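(* Let $\mathbf{v}_1+\mathcal{L}_1,\dots,\mathbf{v}_n+\mathcal{L}_n$ be a lattice tiling of $\mathbb{Z}^d$ in which the sublattice translate with largest determinant is cyclic, i.e. for some index $i$ with $\det\mathcal{L}_i=\max_{1\le j\le n}\det\mathcal{L}_j$ the sublattice $\mathcal{L}_i$ is cyclic. Then the lattice tiling has the translational property.
   Context: A sublattice is a full-rank subgroup of $\mathbb{Z}^d$. Its determinant $\det\mathcal{L}$ is its index in $\mathbb{Z}^d$. A sublattice $\mathcal{L}$ is cyclic if the finite abelian group $\mathbb{Z}^d/\mathcal{L}$ is cyclic. For $\mathbf{v}\in\mathbb{Z}^d$, the set $\mathbf{v}+\mathcal{L}=\{\mathbf{v}+\mathbf{w} : \mathbf{w}\in\mathcal{L}\}$ is called a translate of $\mathcal{L}$ (a sublattice translate); its determinant and cyclicity refer to those of $\mathcal{L}$. A lattice tiling of $\mathbb{Z}^d$ is a finite collection of sublattices $\mathcal{L}_1,\dots,\mathcal{L}_n$ and vectors $\mathbf{v}_1,\dots,\mathbf{v}_n\in\mathbb{Z}^d$ such that $\bigcup_{j=1}^n(\mathbf{v}_j+\mathcal{L}_j)=\mathbb{Z}^d$ and $(\mathbf{v}_i+\mathcal{L}_i)\cap(\mathbf{v}_j+\mathcal{L}_j)=\emptyset$ for all $i\ne j$. A lattice tiling has the translational property if at least two of its translated sublattices are different cosets of the same sublattice, i.e. there exist $i\ne j$ with $\mathcal{L}_i=\mathcal{L}_j$.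
   Formalization: The lattice tiling is assumed to have at least two translates (n ≥ 2); for n = 1 the tiling by Z^d itself has a cyclic (trivial) quotient but no two distinct indices, so the claim fails there. *)

theory Defs
  imports "HOL-Analysis.Cartesian_Space" "HOL-Algebra.Elementary_Groups"
begin

definition Zd_group :: "(int ^ 'd) monoid"
  where "Zd_group = \<lparr>carrier = UNIV, mult = (+), one = 0\<rparr>"

definition real_vec :: "int ^ 'd \<Rightarrow> real ^ 'd"
  where "real_vec v = (\<chi> k. real_of_int (v $ k))"

text \<open>
  The rank of a subgroup \<open>L\<close> of \<open>\<int>\<^sup>d\<close> is the dimension of the real subspace spanned by \<open>L\<close>;
  \<^const>\<open>dim\<close> of a set is the dimension of its span.
\<close>
definition sublattice :: "(int ^ 'd) set \<Rightarrow> bool"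
  where "sublattice L \<longleftrightarrow> subgroup L Zd_group \<and> dim (real_vec ` L) = CARD('d)"

text \<open>
  The number of cosets; since \<^const>\<open>card\<close> is 0 on infinite sets, this is the index only for
  subgroups of finite index, which sublattices are.
\<close>
definition lattice_det :: "(int ^ 'd) set \<Rightarrow> nat"
  where "lattice_det L = card (rcosets\<^bsub>Zd_group\<^esub> L)"

definition cyclic_sublattice :: "(int ^ 'd) set \<Rightarrow> bool"
  where "cyclic_sublattice L \<longleftrightarrow> sublattice L \<and> cyclic_group (Zd_group Mod L)"

definition translate :: "int ^ 'd \<Rightarrow> (int ^ 'd) set \<Rightarrow> (int ^ 'd) set"
  where "translate v L = {v + w | w. w \<in> L}"

text \<open>The tiles are indexed by \<open>{1..n}\<close>; values of \<open>v\<close> and \<open>L\<close> at other indices are irrelevant.\<close>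
definition lattice_tiling :: "nat \<Rightarrow> (nat \<Rightarrow> int ^ 'd) \<Rightarrow> (nat \<Rightarrow> (int ^ 'd) set) \<Rightarrow> bool"
  where "lattice_tiling n v L \<longleftrightarrow>
    (\<forall>j\<in>{1..n}. sublattice (L j)) \<and>
    (\<Union>j\<in>{1..n}. translate (v j) (L j)) = UNIV \<and>
    (\<forall>i\<in>{1..n}. \<forall>j\<in>{1..n}. i \<noteq> j \<longrightarrow> translate (v i) (L i) \<inter> translate (v j) (L j) = {})"

text \<open>
  In a tiling, tiles with distinct indices are disjoint and nonempty, so if they are translates of
  the same sublattice they are automatically different cosets of it.
\<close>
definition translational_property :: "nat \<Rightarrow> (nat \<Rightarrow> (int ^ 'd) set) \<Rightarrow> bool"
  where "translational_property n L \<longleftrightarrow> (\<exists>i\<in>{1..n}. \<exists>j\<in>{1..n}. i \<noteq> j \<and> L i = L j)"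

end

theory Submission
  imports Defs "HOL-Analysis.Determinants" "HOL-Analysis.Complex_Transcendental"
begin

text \<open>
  The proof is Fourier analysis on \<open>\<int>\<^sup>d\<close>. Let \<open>L i\<close> be a cyclic tile of largest
  determinant. A finite cyclic group embeds into the unit circle, so there is a character
  \<open>\<psi> : \<int>\<^sup>d \<rightarrow> \<complex>\<^sup>\<times>\<close> whose kernel is exactly \<open>L i\<close>
  (\<open>cyclic_quotient_imp_character\<close>); this is where cyclicity enters. Average \<open>\<psi>\<close> over
  \<open>\<int>\<^sup>d\<close>, both as a whole and tile by tile. The total is zero, because \<open>\<psi>\<close> is not trivial:
  with two or more tiles, \<open>L i\<close> is not everything. A tile \<open>v j + L j\<close> contributes zero
  unless \<open>\<psi>\<close> is trivial on \<open>L j\<close>, that is, unless \<open>L j \<subseteq> L i\<close>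
  (\<open>sum_character_translate_eq_0\<close>). But the tile \<open>v i + L i\<close>, on which \<open>\<psi>\<close> is
  constant, contributes a nonzero number (\<open>sum_character_kernel_translate_neq_0\<close>). Something must
  cancel it, so \<open>L j \<subseteq> L i\<close> for a second tile \<open>j\<close>
  (\<open>tiling_imp_sublattice_of_cyclic_tile\<close>). As a sublattice of \<open>L i\<close>, \<open>L j\<close> has
  determinant at least that of \<open>L i\<close>, with equality only if \<open>L j = L i\<close>
  (\<open>sublattice_eq_if_subset_and_det_le\<close>); maximality forces equality.

  Averages become finite sums as follows. A subgroup of full rank contains some dilate
  \<open>m\<int>\<^sup>d\<close> (\<open>sublattice_contains_dilate\<close>), so a common multiple \<open>M\<close> of these \<open>m\<close> makes
  all tiles and the character \<open>M\<close>-periodic, and it suffices to sum over the box \<open>[0,M)\<^sup>d\<close>.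
\<close>

section \<open>Subgroups of the integer lattice\<close>

lemma Zd_group_simps [simp]:
  "carrier Zd_group = UNIV" "x \<otimes>\<^bsub>Zd_group\<^esub> y = x + y" "\<one>\<^bsub>Zd_group\<^esub> = 0"
  by (simp_all add: Zd_group_def)

lemma comm_group_Zd_group: "comm_group (Zd_group :: (int ^ 'd) monoid)"
proof (rule comm_groupI)
  fix x :: "int ^ 'd"
  have "- x + x = 0" by simp
  then show "\<exists>y\<in>carrier Zd_group. y \<otimes>\<^bsub>Zd_group\<^esub> x = \<one>\<^bsub>Zd_group\<^esub>"
    unfolding Zd_group_simps by blast
qed (simp_all add: add_ac)

lemma group_Zd_group: "group Zd_group"
  by (rule comm_group.axioms(2)[OF comm_group_Zd_group])

lemma inv_Zd_group [simp]: "inv\<^bsub>Zd_group\<^esub> x = - x"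
  by (rule group.inv_equality[OF group_Zd_group]) simp_all

lemma pow_Zd_group: "x [^]\<^bsub>Zd_group\<^esub> (k::int) = k *s x"
proof -
  have nat_pow: "x [^]\<^bsub>Zd_group\<^esub> (n::nat) = int n *s x" for n
    by (induction n) (simp_all add: vec_eq_iff algebra_simps)
  show ?thesis
    by (cases k rule: int_cases2)
       (simp_all add: int_pow_int group.int_pow_neg_int[OF group_Zd_group] nat_pow vec_eq_iff)
qed

lemma
  assumes "subgroup L Zd_group"
  shows subgroup_Zd_zero: "0 \<in> L"
    and subgroup_Zd_add: "x \<in> L \<Longrightarrow> y \<in> L \<Longrightarrow> x + y \<in> L"
    and subgroup_Zd_uminus: "x \<in> L \<Longrightarrow> - x \<in> L"
  using subgroup.one_closed[OF assms] subgroup.m_closed[OF assms, of x y]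
    subgroup.m_inv_closed[OF assms, of x] by simp_all

lemma subgroup_Zd_diff:
  assumes "subgroup L Zd_group" "x \<in> L" "y \<in> L"
  shows "x - y \<in> L"
  using subgroup_Zd_add[OF assms(1,2) subgroup_Zd_uminus[OF assms(1,3)]] by simp

lemma subgroup_Zd_scale:
  assumes "subgroup L Zd_group" "x \<in> L"
  shows "(k::int) *s x \<in> L"
  using group.subgroup_int_pow_closed[OF group_Zd_group assms, of k] by (simp add: pow_Zd_group)

lemma subgroup_Zd_sum:
  assumes "subgroup L Zd_group" "\<And>i. i \<in> I \<Longrightarrow> f i \<in> L"
  shows "sum f I \<in> L"
  using assms(2)
  by (induction I rule: infinite_finite_induct)
     (simp_all add: subgroup_Zd_zero[OF assms(1)] subgroup_Zd_add[OF assms(1)])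

lemma mem_translate_iff: "x \<in> translate v L \<longleftrightarrow> x - v \<in> L"
proof -
  have "x = v + w \<longleftrightarrow> w = x - v" for w by (auto simp: algebra_simps)
  then show ?thesis by (simp add: translate_def)
qed

lemma r_coset_eq_translate: "L #>\<^bsub>Zd_group\<^esub> a = translate a L"
proof -
  have "x = w + a \<longleftrightarrow> w = x - a" for x w by (auto simp: algebra_simps)
  then show ?thesis by (auto simp: r_coset_def mem_translate_iff)
qed

lemma rcosets_eq_range_translate: "rcosets\<^bsub>Zd_group\<^esub> L = range (\<lambda>a. translate a L)"
  by (auto simp: RCOSETS_def r_coset_eq_translate)

lemma translate_eq_iff:
  assumes "subgroup L Zd_group"
  shows "translate a L = translate b L \<longleftrightarrow> a - b \<in> L"
proof
  assume "translate a L = translate b L"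
  moreover have "a \<in> translate a L"
    by (simp add: mem_translate_iff subgroup_Zd_zero[OF assms])
  ultimately show "a - b \<in> L" by (simp add: mem_translate_iff)
next
  assume ab: "a - b \<in> L"
  have "x - a \<in> L \<longleftrightarrow> x - b \<in> L" for x
    using subgroup_Zd_add[OF assms _ ab, of "x - a"] subgroup_Zd_diff[OF assms _ ab, of "x - b"]
    by auto
  then show "translate a L = translate b L" by (auto simp: mem_translate_iff)
qed

lemma det_of_int: "(det (\<chi> i j. of_int (a i j)) :: real) = of_int (det (\<chi> i j. a i j))"
  unfolding det_def of_int_sum of_int_mult of_int_prod by simp

text \<open>
  Choose \<open>d\<close> vectors of \<open>L\<close> that form a basis of \<open>\<real>\<^sup>d\<close>. By Cramer's rule their determinant
  is a common denominator for the coordinates of every integer vector in this basis. The dilate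
  inside \<open>L\<close> shows that the index is finite and, for several sublattices at once, gives a common
  period.
\<close>
lemma sublattice_contains_dilate:
  fixes L :: "(int ^ 'd) set"
  assumes "sublattice L"
  obtains m :: int where "m > 0" "\<And>x. m *s x \<in> L"
proof -
  have sub: "subgroup L Zd_group" and dim: "dim (real_vec ` L) = CARD('d)"
    using assms by (auto simp: sublattice_def)
  obtain B where B: "B \<subseteq> real_vec ` L" "independent B" "real_vec ` L \<subseteq> span B"
      "card B = dim (real_vec ` L)"
    using basis_exists by blast
  have spanB: "span B = UNIV"
  proof -
    have "span (real_vec ` L) = UNIV" using dim by (simp add: dim_eq_full[symmetric])
    then show ?thesis using span_mono[OF B(3)] by (simp add: span_span top.extremum_unique)
  qed
  have "finite B" using B(2) by (rule independent_imp_finite)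
  then obtain f where f: "bij_betw f (UNIV :: 'd set) B"
    using finite_same_card_bij[of "UNIV :: 'd set" B] B(4) dim by auto
  have "\<forall>k. \<exists>w. w \<in> L \<and> f k = real_vec w"
    using f B(1) by (fastforce simp: bij_betw_def)
  then obtain w where w: "\<And>k. w k \<in> L" "\<And>k. f k = real_vec (w k)" by metis
  define A :: "real ^ 'd ^ 'd" where "A = (\<chi> i j. of_int (w j $ i))"
  define D where "D = det (\<chi> i j. w j $ i)"
  have detA: "det A = of_int D" unfolding A_def D_def by (rule det_of_int)
  have "column j A = f j" for j
    by (simp add: column_def A_def w(2) real_vec_def vec_eq_iff)
  then have "columns A = B" using f by (auto simp: columns_def bij_betw_def)
  then have "invertible A"
    using matrix_right_invertible_span_columns[of A] spanB
    by (simp add: invertible_right_inverse span_vec_eq)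
  then have D0: "D \<noteq> 0" using detA by (simp add: invertible_det_nz)
  have DL: "D *s b \<in> L" for b
  proof -
    define c where "c k = det (\<chi> i j. if j = k then b $ i else w j $ i)" for k
    define x :: "real ^ 'd" where "x = (\<chi> k. of_int (c k) / of_int D)"
    \<comment> \<open>Cramer's rule: the coordinates of \<open>D *s b\<close> in the basis \<open>w\<close> are the integers \<open>c k\<close>.\<close>
    have c: "of_int (c k) = det (\<chi> i j. if j = k then real_vec b $ i else A $ i $ j)" for k
      unfolding c_def det_of_int[symmetric]
      by (rule arg_cong[where f = det]) (simp add: vec_eq_iff real_vec_def A_def)
    have "x = (\<chi> k. det (\<chi> i j. if j = k then real_vec b $ i else A $ i $ j) / det A)"
      by (simp add: x_def c detA)
    then have Ax: "A *v x = real_vec b" using cramer[of A x] D0 detA by simp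
    have "(\<Sum>k\<in>UNIV. c k *s w k) $ i = (D *s b) $ i" for i
    proof -
      have "(\<Sum>k\<in>UNIV. of_int (w k $ i) * (of_int (c k) / of_int D)) = (of_int (b $ i) :: real)"
        using arg_cong[OF Ax, of "\<lambda>y. y $ i"]
        by (simp add: matrix_vector_mult_def A_def x_def real_vec_def)
      then have "(\<Sum>k\<in>UNIV. of_int (c k * w k $ i)) = (of_int (D * b $ i) :: real)"
        using D0 by (simp add: sum_divide_distrib[symmetric] field_simps)
      then have "(\<Sum>k\<in>UNIV. c k * w k $ i) = D * b $ i"
        unfolding of_int_sum[symmetric] of_int_eq_iff .
      then show ?thesis by simp
    qed
    then have "D *s b = (\<Sum>k\<in>UNIV. c k *s w k)" by (simp add: vec_eq_iff)
    then show ?thesis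
      by (simp add: subgroup_Zd_sum[OF sub] subgroup_Zd_scale[OF sub] w(1))
  qed
  show thesis
  proof (rule that)
    show "\<bar>D\<bar> > 0" using D0 by simp
    show "\<bar>D\<bar> *s x \<in> L" for x
    proof (cases "D \<ge> 0")
      case False
      then have "\<bar>D\<bar> *s x = D *s (- x)" by (simp add: vec_eq_iff)
      then show ?thesis using DL by simp
    qed (simp add: DL)
  qed
qed

section \<open>Boxes as fundamental domains\<close>

definition box_mod :: "int \<Rightarrow> (int ^ 'd) set"
  where "box_mod M = {x. \<forall>k. 0 \<le> x $ k \<and> x $ k < M}"

definition vec_mod :: "int \<Rightarrow> int ^ 'd \<Rightarrow> int ^ 'd"
  where "vec_mod M x = (\<chi> k. x $ k mod M)"

lemma finite_box_mod: "finite (box_mod M :: (int ^ 'd) set)"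
proof -
  have "(box_mod M :: (int ^ 'd) set) \<subseteq> vec_lambda ` (UNIV \<rightarrow>\<^sub>E {0..<M})"
  proof
    fix x :: "int ^ 'd" assume "x \<in> box_mod M"
    then have "vec_nth x \<in> UNIV \<rightarrow>\<^sub>E {0..<M}" by (auto simp: box_mod_def)
    then show "x \<in> vec_lambda ` (UNIV \<rightarrow>\<^sub>E {0..<M})" by (metis image_eqI vec_nth_inverse)
  qed
  then show ?thesis by (rule finite_subset) (simp add: finite_PiE)
qed

lemma vec_mod_in_box: "M > 0 \<Longrightarrow> vec_mod M x \<in> box_mod M"
  by (simp add: vec_mod_def box_mod_def)

lemma vec_mod_decomp: "\<exists>y. x = vec_mod M x + M *s y"
  by (rule exI[of _ "\<chi> k. x $ k div M"]) (simp add: vec_eq_iff vec_mod_def)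

lemma finite_rcosets_if_dilate:
  assumes "subgroup L Zd_group" "M > 0" "\<And>x. M *s x \<in> L"
  shows "finite (rcosets\<^bsub>Zd_group\<^esub> L)"
proof -
  have "translate a L = translate (vec_mod M a) L" for a
  proof -
    obtain y where "a = vec_mod M a + M *s y" using vec_mod_decomp by blast
    then have "a - vec_mod M a = M *s y" by (simp add: algebra_simps)
    then show ?thesis by (simp add: translate_eq_iff[OF assms(1)] assms(3))
  qed
  then have "rcosets\<^bsub>Zd_group\<^esub> L \<subseteq> (\<lambda>a. translate a L) ` box_mod M"
    unfolding rcosets_eq_range_translate using vec_mod_in_box[OF assms(2)] by blast
  then show ?thesis using finite_box_mod finite_surj by blast
qed

text \<open>
  The box represents each class modulo \<open>M\<close> exactly once, and a shift permutes these classes.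
\<close>
lemma sum_box_shift:
  fixes g :: "int ^ 'd \<Rightarrow> 'a::comm_monoid_add"
  assumes "M > 0" and per: "\<And>x y. g (x + M *s y) = g x"
  shows "(\<Sum>x\<in>box_mod M. g (x + w)) = sum g (box_mod M)"
proof (rule sum.reindex_bij_witness[where i = "\<lambda>x. vec_mod M (x - w)"
      and j = "\<lambda>x. vec_mod M (x + w)"])
  fix x :: "int ^ 'd" assume "x \<in> box_mod M"
  then have x: "vec_mod M x = x" by (simp add: box_mod_def vec_mod_def vec_eq_iff)
  have "vec_mod M (vec_mod M (x + w) - w) = vec_mod M x"
    "vec_mod M (vec_mod M (x - w) + w) = vec_mod M x"
    by (simp_all add: vec_mod_def vec_eq_iff mod_simps)
  then show "vec_mod M (vec_mod M (x + w) - w) = x" "vec_mod M (vec_mod M (x - w) + w) = x"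
    using x by simp_all
  obtain y where "x + w = vec_mod M (x + w) + M *s y" using vec_mod_decomp by blast
  then show "g (vec_mod M (x + w)) = g (x + w)"
    using per[of "vec_mod M (x + w)" y] by simp
qed (simp_all add: vec_mod_in_box assms(1))

section \<open>Characters\<close>

text \<open>
  If the class of \<open>g\<close> generates the quotient and has order \<open>N\<close>, every \<open>x\<close> is congruent to a
  multiple \<open>l x *s g\<close> modulo \<open>L\<close>, where \<open>l x\<close> is determined modulo \<open>N\<close>. Sending \<open>g\<close> to a
  primitive \<open>N\<close>-th root of unity is therefore well defined and faithful on the quotient.
\<close>
lemma cyclic_quotient_imp_character:
  fixes L :: "(int ^ 'd) set"
  assumes sub: "subgroup L Zd_group" and "cyclic_group (Zd_group Mod L)"
    and "m > 0" and mL: "\<And>x. m *s x \<in> L"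
  obtains \<psi> :: "int ^ 'd \<Rightarrow> complex"
  where "\<And>x y. \<psi> (x + y) = \<psi> x * \<psi> y" and "\<And>x. \<psi> x = 1 \<longleftrightarrow> x \<in> L"
proof -
  have norm: "L \<lhd> Zd_group"
    using comm_group.subgroup_imp_normal[OF comm_group_Zd_group sub] .
  have grp: "group (Zd_group Mod L)" by (rule normal.factorgroup_is_group[OF norm])
  obtain C where C: "C \<in> carrier (Zd_group Mod L)"
      "carrier (Zd_group Mod L) = range (\<lambda>k::int. C [^]\<^bsub>Zd_group Mod L\<^esub> k)"
    using assms(2) group.cyclic_group[OF grp] by blast
  obtain g where g: "C = L #>\<^bsub>Zd_group\<^esub> g" using C(1) by (auto simp: carrier_FactGroup)
  have gen: "\<exists>k. x - k *s g \<in> L" for x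
  proof -
    have "L #>\<^bsub>Zd_group\<^esub> x \<in> carrier (Zd_group Mod L)" by (simp add: carrier_FactGroup)
    then obtain k where "L #>\<^bsub>Zd_group\<^esub> x = C [^]\<^bsub>Zd_group Mod L\<^esub> (k::int)"
      using C(2) by blast
    also have "\<dots> = L #>\<^bsub>Zd_group\<^esub> (k *s g)"
      unfolding g by (simp add: normal.FactGroup_int_pow[OF norm] pow_Zd_group)
    finally show ?thesis by (auto simp: r_coset_eq_translate translate_eq_iff[OF sub])
  qed
  \<comment> \<open>The order of \<open>g\<close> modulo \<open>L\<close>; the period \<open>m\<close> guarantees that it is finite.\<close>
  define N where "N = (LEAST n::nat. n > 0 \<and> int n *s g \<in> L)"
  have "nat m > 0 \<and> int (nat m) *s g \<in> L" using \<open>m > 0\<close> mL by simp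
  then have "N > 0 \<and> int N *s g \<in> L" unfolding N_def by (rule LeastI)
  then have N: "N > 0" "int N *s g \<in> L" by auto
  have N_dvd: "k *s g \<in> L \<longleftrightarrow> int N dvd k" for k
  proof
    assume k: "k *s g \<in> L"
    have "int (nat (k mod int N)) *s g = k *s g - (k div int N) *s (int N *s g)"
    proof -
      have "int (nat (k mod int N)) = k - k div int N * int N"
        using N(1) by (simp add: minus_div_mult_eq_mod)
      then show ?thesis by (simp only:) (simp add: vec_eq_iff algebra_simps)
    qed
    also have "\<dots> \<in> L" by (intro subgroup_Zd_diff[OF sub] subgroup_Zd_scale[OF sub] k N)
    finally have *: "int (nat (k mod int N)) *s g \<in> L" .
    have "nat (k mod int N) < N" using N(1) by (simp add: nat_less_iff)
    then have "\<not> (nat (k mod int N) > 0 \<and> int (nat (k mod int N)) *s g \<in> L)"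
      using not_less_Least[of _ "\<lambda>n. n > 0 \<and> int n *s g \<in> L"] unfolding N_def[symmetric] by blast
    with * have "nat (k mod int N) = 0" by simp
    moreover have "k mod int N \<ge> 0" using N(1) by simp
    ultimately have "k mod int N = 0" by linarith
    then show "int N dvd k" by (simp add: mod_0_imp_dvd)
  next
    assume "int N dvd k"
    then obtain q where "k = int N * q" by (rule dvdE)
    then have "k *s g = q *s (int N *s g)" by (simp add: vec_eq_iff)
    then show "k *s g \<in> L" using subgroup_Zd_scale[OF sub N(2)] by simp
  qed
  define e where "e k = exp (2 * of_real pi * \<i> * of_int k / of_nat N)" for k :: int
  have e_add: "e (j + k) = e j * e k" for j k
    by (simp add: e_def exp_add[symmetric] add_divide_distrib algebra_simps)
  have e_1: "e k = 1 \<longleftrightarrow> int N dvd k" for k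
  proof -
    have "e k = 1 \<longleftrightarrow> (\<exists>q::int. 2 * pi * k / N = of_int (2 * q) * pi)"
      unfolding e_def exp_eq_1 by simp
    also have "\<dots> \<longleftrightarrow> (\<exists>q::int. real_of_int k = real_of_int (int N * q))"
      using N(1) by (intro ex_cong1) (simp add: field_simps)
    also have "\<dots> \<longleftrightarrow> int N dvd k" unfolding of_int_eq_iff by (auto simp: dvd_def)
    finally show ?thesis .
  qed
  obtain l where l: "\<And>x. x - l x *s g \<in> L" using gen by metis
  have add: "e (l (x + y)) = e (l x) * e (l y)" for x y
  proof -
    have "(l (x + y) - (l x + l y)) *s g
        = (x - l x *s g) + (y - l y *s g) - (x + y - l (x + y) *s g)"
      by (simp add: vec_eq_iff algebra_simps)
    also have "\<dots> \<in> L" by (intro subgroup_Zd_diff[OF sub] subgroup_Zd_add[OF sub] l)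
    finally have "e (l (x + y) - (l x + l y)) = 1" by (simp add: e_1 N_dvd)
    then show ?thesis
      using e_add[of "l (x + y) - (l x + l y)" "l x + l y"] by (simp add: e_add)
  qed
  have ker: "e (l x) = 1 \<longleftrightarrow> x \<in> L" for x
  proof -
    have "l x *s g \<in> L \<longleftrightarrow> x \<in> L"
      using subgroup_Zd_add[OF sub l[of x], of "l x *s g"] subgroup_Zd_diff[OF sub _ l[of x], of x]
      by auto
    then show ?thesis by (simp add: e_1 N_dvd)
  qed
  show thesis by (rule that[of "\<lambda>x. e (l x)"]) (rule add, rule ker)
qed

text \<open>
  Shifting by \<open>w\<close> preserves the translate but multiplies the sum by \<open>\<psi> w \<noteq> 1\<close>, so the sum
  vanishes. The case \<open>K = UNIV\<close> is orthogonality of \<open>\<psi>\<close> to the trivial character.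
\<close>
lemma sum_character_translate_eq_0:
  fixes \<psi> :: "int ^ 'd \<Rightarrow> complex"
  assumes sub: "subgroup K Zd_group" and "M > 0" and MK: "\<And>x. M *s x \<in> K"
    and mult: "\<And>x y. \<psi> (x + y) = \<psi> x * \<psi> y" and M1: "\<And>x. \<psi> (M *s x) = 1"
    and w: "w \<in> K" "\<psi> w \<noteq> 1"
  shows "(\<Sum>x\<in>box_mod M. if x \<in> translate a K then \<psi> x else 0) = 0"
proof -
  define g where "g x = (if x \<in> translate a K then \<psi> x else 0)" for x
  have shift: "x + u \<in> translate a K \<longleftrightarrow> x \<in> translate a K" if "u \<in> K" for x u
    using subgroup_Zd_add[OF sub _ that, of "x - a"]
      subgroup_Zd_diff[OF sub _ that, of "x + u - a"]
    by (auto simp: mem_translate_iff algebra_simps)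
  have per: "g (x + M *s y) = g x" for x y by (simp add: g_def shift MK mult M1)
  have "sum g (box_mod M) = (\<Sum>x\<in>box_mod M. g (x + w))"
    using sum_box_shift[where g = g and w = w, OF \<open>M > 0\<close> per] by simp
  also have "\<dots> = (\<Sum>x\<in>box_mod M. \<psi> w * g x)"
    by (rule sum.cong) (simp_all add: g_def shift w(1) mult)
  also have "\<dots> = \<psi> w * sum g (box_mod M)" by (simp add: sum_distrib_left)
  finally have "sum g (box_mod M) = 0" using w(2) by simp
  then show ?thesis by (simp add: g_def)
qed

text \<open>
  On a translate of its kernel the character is a nonzero constant, and the box meets every such
  translate, since it contains a representative of \<open>a\<close> modulo \<open>M\<close>.
\<close>
lemma sum_character_kernel_translate_neq_0:
  fixes \<psi> :: "int ^ 'd \<Rightarrow> complex"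
  assumes "M > 0" and MK: "\<And>x. M *s x \<in> K"
    and mult: "\<And>x y. \<psi> (x + y) = \<psi> x * \<psi> y" and ker: "\<And>x. \<psi> x = 1 \<longleftrightarrow> x \<in> K"
    and sub: "subgroup K Zd_group"
  shows "(\<Sum>x\<in>box_mod M. if x \<in> translate a K then \<psi> x else 0) \<noteq> 0"
proof -
  have const: "\<psi> x = \<psi> a" if "x \<in> translate a K" for x
    using that mult[of "x - a" a] ker[of "x - a"] by (simp add: mem_translate_iff)
  have "\<psi> 0 = 1" using ker subgroup_Zd_zero[OF sub] by blast
  then have "\<psi> a \<noteq> 0" using mult[of a "- a"] by auto
  obtain y where y: "a = vec_mod M a + M *s y" using vec_mod_decomp by blast
  then have "vec_mod M a - a = - (M *s y)" by (simp add: algebra_simps)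
  then have "vec_mod M a \<in> box_mod M \<inter> translate a K"
    using MK subgroup_Zd_uminus[OF sub] \<open>M > 0\<close> by (simp add: mem_translate_iff vec_mod_in_box)
  then have "card (box_mod M \<inter> translate a K) \<noteq> 0"
    by (metis card_0_eq empty_iff finite_Int finite_box_mod)
  moreover have "(\<Sum>x\<in>box_mod M. if x \<in> translate a K then \<psi> x else 0)
      = (\<Sum>x\<in>box_mod M \<inter> translate a K. \<psi> a)"
    unfolding sum.inter_restrict[OF finite_box_mod] by (intro sum.cong refl) (simp add: const)
  ultimately show ?thesis using \<open>\<psi> a \<noteq> 0\<close> by simp
qed

section \<open>The tiling\<close>

text \<open>
  If no other \<open>L j\<close> lay inside the kernel \<open>L i\<close>, the contributions of the tiles to the
  character sum over a common period would all vanish except that of tile \<open>i\<close>, while the whole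
  sum is zero.
\<close>
lemma tiling_imp_sublattice_of_cyclic_tile:
  fixes L :: "nat \<Rightarrow> (int ^ 'd) set"
  assumes "2 \<le> n" and tiling: "lattice_tiling n v L"
    and i: "i \<in> {1..n}" and "cyclic_sublattice (L i)"
  shows "\<exists>j\<in>{1..n}. j \<noteq> i \<and> L j \<subseteq> L i"
proof (rule ccontr)
  assume contra: "\<not> ?thesis"
  let ?T = "\<lambda>j. translate (v j) (L j)"
  have subl: "sublattice (L j)" if "j \<in> {1..n}" for j
    using tiling that by (auto simp: lattice_tiling_def)
  then have sub: "subgroup (L j) Zd_group" if "j \<in> {1..n}" for j
    using that by (auto simp: sublattice_def)
  have "\<exists>m>0. \<forall>x. m *s x \<in> L j" if "j \<in> {1..n}" for j
    by (rule sublattice_contains_dilate[OF subl[OF that]]) blast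
  then obtain m where m: "\<And>j. j \<in> {1..n} \<Longrightarrow> m j > 0"
      "\<And>j x. j \<in> {1..n} \<Longrightarrow> m j *s x \<in> L j"
    by metis
  define M where "M = (\<Prod>j\<in>{1..n}. m j)"
  have "M > 0" unfolding M_def using m(1) by (intro prod_pos) auto
  have M: "M *s x \<in> L j" if "j \<in> {1..n}" for j x
  proof -
    have "M = (\<Prod>k\<in>{1..n} - {j}. m k) * m j"
      unfolding M_def using that by (simp add: prod.remove mult.commute)
    then have "M *s x = (\<Prod>k\<in>{1..n} - {j}. m k) *s (m j *s x)"
      by (simp add: vec_eq_iff mult.assoc)
    then show ?thesis using subgroup_Zd_scale[OF sub m(2)] that by simp
  qed
  obtain \<psi> :: "int ^ 'd \<Rightarrow> complex"
    where mult: "\<And>x y. \<psi> (x + y) = \<psi> x * \<psi> y" and ker: "\<And>x. \<psi> x = 1 \<longleftrightarrow> x \<in> L i"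
    using cyclic_quotient_imp_character[OF sub[OF i] _ \<open>M > 0\<close> M[OF i]] assms(4)
    unfolding cyclic_sublattice_def by blast
  define S where "S j = (\<Sum>x\<in>box_mod M. if x \<in> ?T j then \<psi> x else 0)" for j
  have S_other: "S j = 0" if j: "j \<in> {1..n} - {i}" for j
  proof -
    obtain w where "w \<in> L j" "w \<notin> L i" using contra j by blast
    then show ?thesis
      unfolding S_def using j ker M[OF i] mult
      by (intro sum_character_translate_eq_0[where w = w]) (auto intro: sub M \<open>M > 0\<close>)
  qed
  have S_i: "S i \<noteq> 0"
    unfolding S_def
    by (rule sum_character_kernel_translate_neq_0) (use \<open>M > 0\<close> M[OF i] mult ker sub[OF i] in auto)
  have total: "(\<Sum>j\<in>{1..n}. S j) = (\<Sum>x\<in>box_mod M. \<psi> x)"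
  proof -
    have "(\<Sum>j\<in>{1..n}. if x \<in> ?T j then \<psi> x else 0) = \<psi> x" for x
    proof -
      obtain k where k: "k \<in> {1..n}" "x \<in> ?T k" using tiling unfolding lattice_tiling_def by blast
      have "x \<in> ?T j \<longleftrightarrow> j = k" if "j \<in> {1..n}" for j
        using tiling k that unfolding lattice_tiling_def by blast
      then have "(\<Sum>j\<in>{1..n}. if x \<in> ?T j then \<psi> x else 0) = (\<Sum>j\<in>{1..n}. if j = k then \<psi> x else 0)"
        by (intro sum.cong) auto
      then show ?thesis using k(1) by simp
    qed
    then show ?thesis unfolding S_def by (subst sum.swap) simp
  qed
  obtain j where j: "j \<in> {1..n}" "j \<noteq> i"
    using \<open>2 \<le> n\<close> that[of 1] that[of 2] by (cases "i = 1") auto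
  have "L i \<noteq> UNIV" using contra j by blast
  then obtain w where w: "\<psi> w \<noteq> 1" using ker by blast
  have "(\<Sum>x\<in>box_mod M. \<psi> x) = 0"
  proof -
    have UNIV_sub: "subgroup UNIV (Zd_group :: (int ^ 'd) monoid)"
      using group.subgroup_self[OF group_Zd_group] by simp
    have "\<psi> (M *s x) = 1" for x using ker M[OF i] by simp
    from sum_character_translate_eq_0[OF UNIV_sub \<open>M > 0\<close> UNIV_I mult this UNIV_I w, of 0]
    show ?thesis by (simp add: mem_translate_iff)
  qed
  moreover have "(\<Sum>j\<in>{1..n}. S j) = S i"
    using i S_other by (simp add: sum.remove)
  ultimately show False using total S_i by simp
qed

text \<open>
  For \<open>K \<subseteq> L\<close> the coset \<open>a + K\<close> determines the coset \<open>a + L\<close>, and every coset of \<open>L\<close> arises. By the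
  determinants and finiteness this surjection is injective, so \<open>L\<close> contains a single coset
  of \<open>K\<close>.
\<close>
lemma sublattice_eq_if_subset_and_det_le:
  assumes K: "sublattice K" and L: "subgroup L Zd_group" and "K \<subseteq> L"
    and "lattice_det K \<le> lattice_det L"
  shows "K = L"
proof (rule subset_antisym[OF \<open>K \<subseteq> L\<close>])
  have sub: "subgroup K Zd_group" using K by (simp add: sublattice_def)
  let ?f = "\<lambda>C. {c + l | c l. c \<in> C \<and> l \<in> L}"
  have f: "?f (translate a K) = translate a L" for a
  proof (intro equalityI subsetI)
    fix x assume "x \<in> ?f (translate a K)"
    then obtain c l where "x = c + l" "c - a \<in> L" "l \<in> L"
      using \<open>K \<subseteq> L\<close> by (auto simp: mem_translate_iff)
    then show "x \<in> translate a L"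
      using subgroup_Zd_add[OF L, of "c - a" l] by (simp add: mem_translate_iff algebra_simps)
  next
    fix x assume "x \<in> translate a L"
    then have "x = a + (x - a) \<and> a \<in> translate a K \<and> x - a \<in> L"
      by (simp add: mem_translate_iff subgroup_Zd_zero[OF sub])
    then show "x \<in> ?f (translate a K)" by blast
  qed
  \<comment> \<open>Adding \<open>L\<close> elementwise turns \<open>a + K\<close> into \<open>a + L\<close> without choosing representatives.\<close>
  have img: "?f ` (rcosets\<^bsub>Zd_group\<^esub> K) = rcosets\<^bsub>Zd_group\<^esub> L"
    unfolding rcosets_eq_range_translate image_image f by (rule refl)
  have fin: "finite (rcosets\<^bsub>Zd_group\<^esub> K)"
  proof (rule sublattice_contains_dilate[OF K])
    fix m :: int
    assume "m > 0" "\<And>x. m *s x \<in> K"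
    then show ?thesis by (rule finite_rcosets_if_dilate[OF sub])
  qed
  have "card (?f ` (rcosets\<^bsub>Zd_group\<^esub> K)) = card (rcosets\<^bsub>Zd_group\<^esub> K)"
    using card_image_le[OF fin, of ?f] assms(4) by (simp add: lattice_det_def img)
  then have inj: "inj_on ?f (rcosets\<^bsub>Zd_group\<^esub> K)"
    by (rule eq_card_imp_inj_on[OF fin])
  show "L \<subseteq> K"
  proof
    fix x assume "x \<in> L"
    then have "translate x L = translate 0 L" by (simp add: translate_eq_iff[OF L])
    then have eq: "?f (translate x K) = ?f (translate 0 K)" unfolding f .
    have mem: "translate b K \<in> rcosets\<^bsub>Zd_group\<^esub> K" for b
      by (simp add: rcosets_eq_range_translate)
    from inj_onD[OF inj eq mem mem] show "x \<in> K" by (simp add: translate_eq_iff[OF sub])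
  qed
qed

theorem theorem1p5:
  fixes n :: nat
    and v :: "nat \<Rightarrow> int ^ 'd"
    and L :: "nat \<Rightarrow> (int ^ 'd) set"
  assumes "2 \<le> n"
    and "lattice_tiling n v L"
    and "\<exists>i\<in>{1..n}. lattice_det (L i) = Max ((\<lambda>j. lattice_det (L j)) ` {1..n})
                   \<and> cyclic_sublattice (L i)"
  shows "translational_property n L"
proof -
  obtain i where i: "i \<in> {1..n}" "cyclic_sublattice (L i)"
      and max: "lattice_det (L i) = Max ((\<lambda>j. lattice_det (L j)) ` {1..n})"
    using assms(3) by blast
  obtain j where j: "j \<in> {1..n}" "j \<noteq> i" "L j \<subseteq> L i"
    using tiling_imp_sublattice_of_cyclic_tile[OF assms(1,2) i] by blast
  have "sublattice (L j)" "subgroup (L i) Zd_group"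
    using assms(2) i(1) j(1) by (auto simp: lattice_tiling_def sublattice_def)
  moreover have "lattice_det (L j) \<le> lattice_det (L i)" unfolding max using j(1) by simp
  ultimately have "L j = L i" using sublattice_eq_if_subset_and_det_le j(3) by blast
  then show ?thesis using i(1) j(1,2) unfolding translational_property_def by blast
qed

end
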